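(* Let $C, d \ge 1$ be integers, let $A \in \mathbb{R}^{C\times d}$ have rows $a_1,\dots,a_C$, let $b=(b_1,\dots,b_C)\in\mathbb{R}^C$, and let $p_\theta(z)_i = \frac{e^{a_i\cdot z+b_i}}{\sum_{j=1}^C e^{a_j\cdot z+b_j}}$ for $z\in\mathbb{R}^d$ and $1\le i\le C$. Let $z\in\mathbb{R}^d$ be a feature whose local region $\Omega$ follows the Gaussian distribution $\mathcal{N}(z,\Sigma)$ with covariance matrix $\Sigma\in\mathbb{R}^{d\times d}$. Then the expected Kullback-Leibler divergence between the predicted probability at the center $z$ and the predicted probability over the region satisfies $$ \mathbb{E}_{\tilde z\sim\mathcal{N}(z,\Sigma)}\, \mathrm{KL}\big(p_\theta(z)\,\|\,p_\theta(\tilde z)\big) \;\le\; \sum_{j=1}^C \frac{e^{a_j\cdot z+b_j}}{\sum_{k=1}^C e^{a_k\cdot z+b_k}}\cdot \log\left(\sum_{i=1}^C \frac{e^{a_i\cdot z+b_i}}{\sum_{k=1}^C e^{a_k\cdot z+b_k}}\cdot e^{\frac12 (a_i-a_j)\Sigma(a_i-a_j)^{\top}}\right). $$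
   Context: The $a_i\in\mathbb{R}^d$ are regarded as row vectors (rows of the weight matrix $A$ of the final affine layer of a classifier), $a_i\cdot z$ is the Euclidean inner product, and $b$ is the bias of that layer; thus $p_\theta(z)=\mathrm{softmax}(Az+b)$ is the predicted probability vector over $C$ classes. For probability vectors $p,q\in\mathbb{R}^C$ with positive entries, $\mathrm{KL}(p\|q)=\sum_{i=1}^C p_i\log\frac{p_i}{q_i}$, with $\log$ the natural logarithm. $\mathcal{N}(z,\Sigma)$ denotes the multivariate Gaussian distribution on $\mathbb{R}^d$ with mean $z$ and covariance $\Sigma$ (symmetric positive semidefinite). The right-hand side of the inequality is called the Regional Instability $\mathcal{L}_{RI}$. *)

theory Defs
  imports "HOL-Probability.Probability"
begin

definition softmax :: "real ^ 'c \<Rightarrow> real ^ 'c" where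
  "softmax y = (\<chi> i. exp (y $ i) / (\<Sum>j\<in>UNIV. exp (y $ j)))"

text \<open>The rows of \<open>A\<close> are the vectors written \<open>a\<^sub>i\<close> on paper, so that
  \<open>(A *v z + b) $ i = row i A \<bullet> z + b $ i\<close>.\<close>

definition predicted_prob :: "real ^ 'd ^ 'c \<Rightarrow> real ^ 'c \<Rightarrow> real ^ 'd \<Rightarrow> real ^ 'c" where
  "predicted_prob A b z = softmax (A *v z + b)"

lemma predicted_prob_nth:
  "predicted_prob A b z $ i =
     exp (row i A \<bullet> z + b $ i) / (\<Sum>j\<in>UNIV. exp (row j A \<bullet> z + b $ j))"
  by (simp add: predicted_prob_def softmax_def matrix_vector_mul_component row_def)

definition KL :: "real ^ 'c \<Rightarrow> real ^ 'c \<Rightarrow> real" where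
  "KL p q = (\<Sum>i\<in>UNIV. p $ i * ln (p $ i / q $ i))"

definition pos_semidef :: "real ^ 'd ^ 'd \<Rightarrow> bool" where
  "pos_semidef S \<longleftrightarrow> transpose S = S \<and> (\<forall>x. 0 \<le> x \<bullet> (S *v x))"

definition std_gaussian :: "(real ^ 'd) measure" where
  "std_gaussian = density lborel (\<lambda>x. ennreal (\<Prod>i\<in>UNIV. std_normal_density (x $ i)))"

text \<open>A law is \<open>N(\<mu>, S)\<close> if it is the law of \<open>\<mu> + L X\<close> for a standard Gaussian vector \<open>X\<close>
  and a square matrix \<open>L\<close> with \<open>L L\<^sup>T = S\<close>. Unlike the definition through a Lebesgue density,
  this also covers singular \<open>S\<close>. Such an \<open>L\<close> exists exactly when \<open>S\<close> is symmetric positive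
  semidefinite (the law does not depend on its choice); see \<open>ex_multivariate_gaussian\<close> below.\<close>

definition multivariate_gaussian :: "real ^ 'd \<Rightarrow> real ^ 'd ^ 'd \<Rightarrow> (real ^ 'd) measure \<Rightarrow> bool" where
  "multivariate_gaussian \<mu> S M \<longleftrightarrow>
     (\<exists>L :: real ^ 'd ^ 'd. L ** transpose L = S \<and>
        M = distr std_gaussian borel (\<lambda>x. \<mu> + L *v x))"

lemma quad_form_sum:
  fixes S :: "real ^ 'd ^ 'd"
  shows "x \<bullet> (S *v x) = (\<Sum>i\<in>UNIV. \<Sum>j\<in>UNIV. S $ i $ j * x $ i * x $ j)"
  by (simp add: inner_vec_def matrix_vector_mult_def sum_distrib_left mult_ac)

lemma pos_semidef_sym: "pos_semidef S \<Longrightarrow> S $ i $ j = S $ j $ i"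
  unfolding pos_semidef_def transpose_def vec_eq_iff by simp

lemma quad_form_two:
  fixes S :: "real ^ 'd ^ 'd"
  assumes "pos_semidef S"
  shows "(x + t *\<^sub>R axis s 1) \<bullet> (S *v (x + t *\<^sub>R axis s 1)) =
     x \<bullet> (S *v x) + 2 * t * (S *v x) $ s + t\<^sup>2 * S $ s $ s"
proof -
  have "x \<bullet> (S *v axis s 1) = (x v* S) \<bullet> axis s 1"
    by (simp only: dot_lmul_matrix)
  also have "x v* S = S *v x"
    using assms by (simp add: pos_semidef_def flip: transpose_matrix_vector)
  finally have 1: "x \<bullet> (S *v axis s 1) = (S *v x) $ s"
    by (simp add: inner_axis)
  have 2: "axis s 1 \<bullet> (S *v x) = (S *v x) $ s" for x
    by (simp add: inner_axis')
  have 3: "(S *v axis s 1) $ s = S $ s $ s"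
    by (simp add: matrix_vector_mul_component inner_axis)
  show ?thesis
    by (simp add: matrix_vector_right_distrib matrix_vector_mult_scaleR inner_add_left inner_add_right 1 2 3 power2_eq_square
        algebra_simps)
qed

lemma pos_semidef_sum_outer:
  fixes S :: "real ^ 'd ^ 'd"
  assumes "finite F" "pos_semidef S" "\<And>i j. i \<notin> F \<Longrightarrow> S $ i $ j = 0"
  shows "\<exists>v :: 'd \<Rightarrow> real ^ 'd. \<forall>i j. S $ i $ j = (\<Sum>k\<in>F. v k $ i * v k $ j)"
  using assms
proof (induction F arbitrary: S rule: finite_induct)
  case empty
  then show ?case by simp
next
  case (insert s F)
  note psd = insert.prems(1) and sym = pos_semidef_sym[OF insert.prems(1)]
  define c where "c = S $ s $ s"
  have c0: "c \<ge> 0"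
    using quad_form_two[OF psd, of 0 1 s] psd unfolding c_def pos_semidef_def
    by (metis add.left_neutral inner_zero_left matrix_vector_mult_0_right mult_zero_right
        one_power2 mult_1 zero_index)
  have quad: "0 \<le> x \<bullet> (S *v x) + 2 * t * (S *v x) $ s + t\<^sup>2 * c" for x t
    using quad_form_two[OF psd, of x t s] psd unfolding pos_semidef_def c_def by metis
  have key: "((S *v x) $ s)\<^sup>2 \<le> c * (x \<bullet> (S *v x))" if "c > 0" for x
    using quad[of x "- (S *v x) $ s / c"] that
    by (simp add: power2_eq_square field_simps)
  have zero: "S $ s $ j = 0" if "c = 0" for j
  proof (rule ccontr)
    assume ne: "S $ s $ j \<noteq> 0"
    have e: "(S *v axis j 1) $ s = S $ s $ j"
      by (simp add: matrix_vector_mul_component inner_axis)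
    define q where "q = axis j 1 \<bullet> (S *v axis j (1::real))"
    show False
      using quad[of "axis j 1" "- (q + 1) / (2 * S $ s $ j)"] ne that
      unfolding e q_def[symmetric] by (simp add: field_simps)
  qed
  define w where "w = (if c = 0 then 0 else (\<chi> i. S $ s $ i / sqrt c))"
  define S' where "S' = (\<chi> i j. S $ i $ j - w $ i * w $ j)"
  have S'_nth: "S' $ i $ j = S $ i $ j - w $ i * w $ j" for i j
    by (simp add: S'_def)
  have S'mult: "x \<bullet> (S' *v x) = x \<bullet> (S *v x) - (w \<bullet> x)\<^sup>2" for x
  proof -
    have "(w \<bullet> x)\<^sup>2 = (\<Sum>i\<in>UNIV. \<Sum>j\<in>UNIV. w $ i * w $ j * x $ i * x $ j)"
      by (simp add: inner_vec_def power2_eq_square sum_product mult_ac)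
    then show ?thesis
      by (simp only: quad_form_sum S'_nth left_diff_distrib sum_subtractf)
  qed
  have wx: "(w \<bullet> x)\<^sup>2 \<le> x \<bullet> (S *v x)" for x
  proof (cases "c = 0")
    case True
    then show ?thesis using psd by (simp add: w_def pos_semidef_def)
  next
    case False
    then have cp: "c > 0" using c0 by simp
    have "w \<bullet> x = (S *v x) $ s / sqrt c"
      using False by (simp add: w_def inner_vec_def matrix_vector_mult_def sum_divide_distrib)
    then have "(w \<bullet> x)\<^sup>2 = ((S *v x) $ s)\<^sup>2 / c"
      using cp by (simp add: power_divide)
    then show ?thesis using key[OF cp, of x] cp by (simp add: pos_divide_le_eq mult.commute)
  qed
  have psd': "pos_semidef S'"
    unfolding pos_semidef_def
  proof (intro conjI allI)
    show "transpose S' = S'"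
      by (simp add: vec_eq_iff transpose_def S'_nth sym mult.commute)
    show "0 \<le> x \<bullet> (S' *v x)" for x
      using wx[of x] by (simp add: S'mult)
  qed
  have supp: "S' $ i $ j = 0" if "i \<notin> F" for i j
  proof (cases "i = s")
    case True
    show ?thesis
    proof (cases "c = 0")
      case True
      then show ?thesis using zero \<open>i = s\<close> by (simp add: S'_nth w_def)
    next
      case False
      then have "c > 0" using c0 by simp
      then show ?thesis using \<open>i = s\<close>
        by (simp add: S'_nth w_def c_def[symmetric] real_div_sqrt)
    qed
  next
    case False
    then have "S $ i $ j = 0" for j using insert.prems(2) that by auto
    then show ?thesis by (simp add: S'_nth w_def sym[of s i])
  qed
  obtain v where v: "\<And>i j. S' $ i $ j = (\<Sum>k\<in>F. v k $ i * v k $ j)"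
    using insert.IH[OF psd' supp] by blast
  have "S $ i $ j = (\<Sum>k\<in>insert s F. (v(s := w)) k $ i * (v(s := w)) k $ j)" for i j
  proof -
    have "(\<Sum>k\<in>F. (v(s := w)) k $ i * (v(s := w)) k $ j) = (\<Sum>k\<in>F. v k $ i * v k $ j)"
      using insert.hyps by (intro sum.cong) auto
    then show ?thesis using insert.hyps v[of i j] by (simp add: S'_nth)
  qed
  then show ?case by blast
qed

lemma ex_multivariate_gaussian:
  fixes S :: "real ^ 'd ^ 'd"
  assumes "pos_semidef S"
  shows "\<exists>M. multivariate_gaussian \<mu> S M"
proof -
  obtain v :: "'d \<Rightarrow> real ^ 'd" where v: "\<And>i j. S $ i $ j = (\<Sum>k\<in>UNIV. v k $ i * v k $ j)"
    using pos_semidef_sum_outer[of UNIV S] assms by auto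
  have "(\<chi> i k. v k $ i) ** transpose (\<chi> i k. v k $ i) = S"
    by (simp add: vec_eq_iff matrix_matrix_mult_def transpose_def v)
  then show ?thesis
    unfolding multivariate_gaussian_def by blast
qed

end

theory Submission imports Defs
begin

text \<open>The ratio \<open>p\<^sub>j(z) / p\<^sub>j(z')\<close> is the \<open>p(z)\<close>-average over \<open>i\<close> of
  \<open>exp ((a\<^sub>i - a\<^sub>j) \<bullet> (z' - z))\<close>. Jensen's inequality moves the expectation inside the logarithm,
  where the moment generating function of the Gaussian evaluates it. The \<open>i = j\<close> term bounds the
  ratio below by \<open>p\<^sub>j(z) > 0\<close>, which makes its logarithm integrable.\<close>

text \<open>\<open>lborel_eq\<close> presents \<open>lborel\<close> as the image of a product of
  one-dimensional Lebesgue measures under the map from coordinates to vectors. Pulled back along it,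
  both claims become Fubini for a finite product.\<close>

lemma
  fixes f :: "'a::euclidean_space \<Rightarrow> real \<Rightarrow> real"
  assumes "\<And>b. b \<in> Basis \<Longrightarrow> integrable lborel (f b)"
  shows integrable_lborel_prod_Basis:
      "integrable lborel (\<lambda>x::'a. \<Prod>b\<in>Basis. f b (x \<bullet> b))" (is ?I)
    and integral_lborel_prod_Basis:
      "(\<integral>x. (\<Prod>b\<in>Basis. f b ((x::'a) \<bullet> b)) \<partial>lborel) = (\<Prod>b\<in>Basis. \<integral>t. f b t \<partial>lborel)" (is ?E)
proof -
  interpret product_sigma_finite "\<lambda>_::'a. lborel :: real measure"
    by standard
  have [measurable]: "f b \<in> borel_measurable borel" if "b \<in> Basis" for b
    using assms[OF that] by auto
  have meas: "(\<lambda>x::'a. \<Prod>b\<in>Basis. f b (x \<bullet> b)) \<in> borel_measurable borel"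
    by measurable
  have meas_sum: "(\<lambda>h. \<Sum>b\<in>Basis. h b *\<^sub>R b) \<in> measurable (\<Pi>\<^sub>M b\<in>(Basis::'a set). lborel) borel"
    by measurable
  have inner_eq: "(\<Prod>b\<in>Basis. f b ((\<Sum>c\<in>Basis. h c *\<^sub>R c) \<bullet> b)) = (\<Prod>b\<in>Basis. f b (h b))" for h
    by (intro prod.cong refl) (simp add: inner_sum_left_Basis)
  show ?I
    unfolding lborel_eq[where 'a = 'a] integrable_distr_eq[OF meas_sum meas] inner_eq
    by (rule product_integrable_prod) (use assms in auto)
  show ?E
    unfolding lborel_eq[where 'a = 'a] integral_distr[OF meas_sum meas] inner_eq
    by (rule product_integral_prod) (use assms in auto)
qed

lemma prod_Basis_vec:
  fixes g :: "real ^ 'd \<Rightarrow> 'a::comm_monoid_mult"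
  shows "(\<Prod>b\<in>Basis. g b) = (\<Prod>i\<in>UNIV. g (axis i 1))"
proof -
  have "(Basis :: (real ^ 'd) set) = range (\<lambda>i. axis i 1)"
    by (auto simp: Basis_vec_def)
  moreover have "inj (\<lambda>i::'d. axis i (1::real))"
    by (simp add: inj_on_def axis_eq_axis)
  ultimately show ?thesis
    by (metis (no_types, lifting) prod.reindex_cong)
qed

lemma
  fixes f :: "'d::finite \<Rightarrow> real \<Rightarrow> real"
  assumes "\<And>i. integrable lborel (f i)"
  shows integrable_lborel_prod_vec:
      "integrable lborel (\<lambda>x::real ^ 'd. \<Prod>i\<in>UNIV. f i (x $ i))"
    and integral_lborel_prod_vec:
      "(\<integral>x. (\<Prod>i\<in>UNIV. f i ((x::real ^ 'd) $ i)) \<partial>lborel) = (\<Prod>i\<in>UNIV. \<integral>t. f i t \<partial>lborel)"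
proof -
  \<comment> \<open>The general result indexes its factors by basis vectors;
    \<open>axis_index\<close> recovers the coordinate \<open>i\<close> from
    \<open>axis i 1\<close>.\<close>
  define g where "g b = f (axis_index b)" for b :: "real ^ 'd"
  have g: "g (axis i 1) = f i" for i
    by (simp add: g_def)
  have *: "integrable lborel (g b)" for b
    by (simp add: g_def assms)
  show "integrable lborel (\<lambda>x::real ^ 'd. \<Prod>i\<in>UNIV. f i (x $ i))"
    using integrable_lborel_prod_Basis[of g, OF *] by (simp add: prod_Basis_vec g inner_axis)
  show "(\<integral>x. (\<Prod>i\<in>UNIV. f i ((x::real ^ 'd) $ i)) \<partial>lborel) = (\<Prod>i\<in>UNIV. \<integral>t. f i t \<partial>lborel)"
    using integral_lborel_prod_Basis[of g, OF *] by (simp add: prod_Basis_vec g inner_axis)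
qed

text \<open>Completing the square: the exponential weight only moves the mean to \<open>w\<close>,
  at the cost of the constant \<open>exp (w\<^sup>2 / 2)\<close>.\<close>

lemma std_normal_density_exp_tilt:
  "std_normal_density t * exp (w * t) = exp (w\<^sup>2 / 2) * normal_density w 1 t"
proof -
  have "- t\<^sup>2 / 2 + w * t = w\<^sup>2 / 2 + - (t - w)\<^sup>2 / 2"
    by (simp add: power2_eq_square field_simps)
  then show ?thesis
    by (simp add: normal_density_def flip: exp_add)
qed

text \<open>Density and exponential both factor over the coordinates. After tilting, each factor is
  a constant times a normal density of total mass 1, so only the constants survive.\<close>

lemma
  fixes w :: "real ^ 'd"
  shows integrable_std_gaussian_exp: "integrable std_gaussian (\<lambda>x. exp (w \<bullet> x))"
    and integral_std_gaussian_exp: "(\<integral>x. exp (w \<bullet> x) \<partial>std_gaussian) = exp (w \<bullet> w / 2)"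
proof -
  have eq: "(\<Prod>i\<in>UNIV. std_normal_density (x $ i)) * exp (w \<bullet> x)
      = (\<Prod>i\<in>UNIV. exp ((w $ i)\<^sup>2 / 2) * normal_density (w $ i) 1 (x $ i))" for x :: "real ^ 'd"
    by (simp add: inner_vec_def exp_sum flip: std_normal_density_exp_tilt prod.distrib)
  have int: "integrable lborel (\<lambda>t. exp ((w $ i)\<^sup>2 / 2) * normal_density (w $ i) 1 t)" for i
    by simp
  have meas: "(\<lambda>x::real ^ 'd. \<Prod>i\<in>UNIV. std_normal_density (x $ i)) \<in> borel_measurable lborel"
    by measurable
  show "integrable std_gaussian (\<lambda>x. exp (w \<bullet> x))"
    unfolding std_gaussian_def
    by (subst integrable_density)
      (use meas integrable_lborel_prod_vec[of "\<lambda>i t. exp ((w $ i)\<^sup>2 / 2) * normal_density (w $ i) 1 t", OF int] in \<open>auto simp: eq intro!: prod_nonneg\<close>)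
  have "(\<integral>x. exp (w \<bullet> x) \<partial>std_gaussian) = (\<Prod>i\<in>UNIV. exp ((w $ i)\<^sup>2 / 2))"
    unfolding std_gaussian_def
    by (subst integral_density)
      (use meas integral_lborel_prod_vec[of "\<lambda>i t. exp ((w $ i)\<^sup>2 / 2) * normal_density (w $ i) 1 t", OF int] in \<open>auto simp: eq intro!: prod_nonneg\<close>)
  also have "\<dots> = exp (w \<bullet> w / 2)"
    by (simp add: inner_vec_def sum_divide_distrib exp_sum power2_eq_square)
  finally show "(\<integral>x. exp (w \<bullet> x) \<partial>std_gaussian) = exp (w \<bullet> w / 2)" .
qed

lemma
  fixes v :: "real ^ 'd"
  assumes "multivariate_gaussian \<mu> S M"
  shows integrable_gaussian_exp: "integrable M (\<lambda>x. exp (v \<bullet> (x - \<mu>)))"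
    and integral_gaussian_exp: "(\<integral>x. exp (v \<bullet> (x - \<mu>)) \<partial>M) = exp (1 / 2 * (v \<bullet> (S *v v)))"
proof -
  obtain L :: "real ^ 'd ^ 'd" where L: "L ** transpose L = S"
    and M: "M = distr std_gaussian borel (\<lambda>x. \<mu> + L *v x)"
    using assms unfolding multivariate_gaussian_def by blast
  \<comment> \<open>Moving \<open>L\<close> to the other side of the inner product reduces the claim
    to the standard Gaussian. No inverse of \<open>L\<close> is taken, so a singular
    \<open>S\<close> is covered.\<close>
  define w where "w = transpose L *v v"
  have w: "v \<bullet> (L *v x) = w \<bullet> x" for x
    by (simp add: w_def dot_lmul_matrix)
  have ww: "w \<bullet> w = v \<bullet> (S *v v)"
    by (simp only: L[symmetric] w matrix_vector_mul_assoc[symmetric] flip: w_def)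
  have [measurable]: "(\<lambda>x. \<mu> + L *v x) \<in> measurable std_gaussian borel"
    by (simp add: std_gaussian_def borel_measurable_continuous_onI continuous_intros)
  show "integrable M (\<lambda>x. exp (v \<bullet> (x - \<mu>)))"
    by (simp add: M integrable_distr_eq w integrable_std_gaussian_exp)
  show "(\<integral>x. exp (v \<bullet> (x - \<mu>)) \<partial>M) = exp (1 / 2 * (v \<bullet> (S *v v)))"
    by (simp add: M integral_distr w integral_std_gaussian_exp ww)
qed

lemma prob_space_multivariate_gaussian:
  assumes "multivariate_gaussian \<mu> S M"
  shows "prob_space M"
proof -
  \<comment> \<open>The moment generating function at 0 is the total mass.\<close>
  have "measure M (space M) = 1"
    using integral_gaussian_exp[OF assms, of 0] by simp
  \<comment> \<open>\<open>measure\<close> is 0 where \<open>emeasure\<close> is infinite, so the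
    value 1 rules out infinite mass.\<close>
  then have "emeasure M (space M) = 1"
    by (metis emeasure_eq_ennreal_measure ennreal_1 measure_zero_top zero_neq_one)
  then show ?thesis
    by (rule prob_spaceI)
qed

lemma (in prob_space)
  fixes Y :: "'a \<Rightarrow> real"
  assumes Y: "integrable M Y" and c: "0 < c" "\<And>x. x \<in> space M \<Longrightarrow> c \<le> Y x"
  shows integrable_ln_bounded_below: "integrable M (\<lambda>x. ln (Y x))" (is ?I)
    and expectation_ln_le: "expectation (\<lambda>x. ln (Y x)) \<le> ln (expectation Y)" (is ?E)
proof -
  show I: ?I
  proof (rule Bochner_Integration.integrable_bound)
    show "integrable M (\<lambda>x. Y x + \<bar>ln c\<bar>)"
      using Y by simp
    show "(\<lambda>x. ln (Y x)) \<in> borel_measurable M"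
      using Y by measurable
    \<comment> \<open>The logarithm is squeezed between the constant \<open>ln c\<close> and the
      integrable \<open>Y x - 1\<close>, which gives an integrable dominating function.\<close>
    have "\<bar>ln (Y x)\<bar> \<le> Y x + \<bar>ln c\<bar>" if "x \<in> space M" for x
    proof -
      have "ln c \<le> ln (Y x)" "ln (Y x) \<le> Y x - 1"
        using c(1) c(2)[OF that] by (auto intro: ln_le_minus_one)
      moreover have "0 < Y x"
        using c(1) c(2)[OF that] by linarith
      ultimately show ?thesis by linarith
    qed
    then show "AE x in M. norm (ln (Y x)) \<le> norm (Y x + \<bar>ln c\<bar>)"
      by (intro AE_I2) force
  qed
  have "expectation Y \<ge> c"
    using integral_mono[of M "\<lambda>_. c" Y] Y c(2) by (simp add: prob_space)
  then have pos: "0 < expectation Y"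
    using c(1) by linarith
  \<comment> \<open>This is the tangent to \<open>ln\<close> at \<open>expectation Y\<close>. Its
    linear term has mean 0, so integrating it yields Jensen's inequality.\<close>
  have "ln (Y x) \<le> ln (expectation Y) + (Y x / expectation Y - 1)" if "x \<in> space M" for x
  proof -
    have "0 < Y x"
      using c(1) c(2)[OF that] by linarith
    then show ?thesis
      using ln_le_minus_one[of "Y x / expectation Y"] pos by (simp add: ln_div)
  qed
  then have "expectation (\<lambda>x. ln (Y x)) \<le> expectation (\<lambda>x. ln (expectation Y) + (Y x / expectation Y - 1))"
    using I Y by (intro integral_mono) auto
  also have "\<dots> = ln (expectation Y)"
    using Y pos by (simp add: prob_space)
  finally show ?E .
qed

lemma predicted_prob_pos: "0 < predicted_prob A b z $ j"
  by (simp add: predicted_prob_nth sum_pos)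

text \<open>Dividing by the probability at \<open>z'\<close> puts its normalising sum into the
  numerator, which is the sum over \<open>i\<close>. The biases cancel because the logits at
  \<open>z'\<close> and \<open>z\<close> differ by
  \<open>row i A \<bullet> (z' - z)\<close>.\<close>

lemma predicted_prob_ratio:
  "predicted_prob A b z $ j / predicted_prob A b z' $ j =
    (\<Sum>i\<in>UNIV. predicted_prob A b z $ i * exp ((row i A - row j A) \<bullet> (z' - z)))"
proof -
  let ?Z = "\<Sum>k\<in>UNIV. exp (row k A \<bullet> z + b $ k)"
  have "predicted_prob A b z $ j / predicted_prob A b z' $ j =
      (\<Sum>i\<in>UNIV. exp (row j A \<bullet> z + b $ j) * exp (row i A \<bullet> z' + b $ i)
        / exp (row j A \<bullet> z' + b $ j) / ?Z)"
    by (simp add: predicted_prob_nth sum_distrib_left sum_divide_distrib[symmetric] mult_ac)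
  also have "\<dots> = (\<Sum>i\<in>UNIV. predicted_prob A b z $ i * exp ((row i A - row j A) \<bullet> (z' - z)))"
    by (intro sum.cong refl)
      (simp add: predicted_prob_nth inner_diff_left inner_diff_right exp_diff exp_add ac_simps)
  finally show ?thesis .
qed

text \<open>A Bochner integral is 0 by convention when the integrand is not integrable; the
  integrability conjunct ensures that the bound concerns a genuine expectation.\<close>

theorem proposition4p4:
  fixes A :: "real ^ 'd ^ 'c" and b :: "real ^ 'c"
    and z :: "real ^ 'd" and \<Sigma> :: "real ^ 'd ^ 'd" and N :: "(real ^ 'd) measure"
  assumes "pos_semidef \<Sigma>"
    and "multivariate_gaussian z \<Sigma> N"
  shows "integrable N (\<lambda>z'. KL (predicted_prob A b z) (predicted_prob A b z')) \<and>
    (\<integral>z'. KL (predicted_prob A b z) (predicted_prob A b z') \<partial>N)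
      \<le> (\<Sum>j\<in>UNIV. exp (row j A \<bullet> z + b $ j) / (\<Sum>k\<in>UNIV. exp (row k A \<bullet> z + b $ k)) *
           ln (\<Sum>i\<in>UNIV. exp (row i A \<bullet> z + b $ i) / (\<Sum>k\<in>UNIV. exp (row k A \<bullet> z + b $ k)) *
                 exp (1 / 2 * ((row i A - row j A) \<bullet> (\<Sigma> *v (row i A - row j A))))))"
proof -
  note gauss = assms(2)
  interpret prob_space N
    by (rule prob_space_multivariate_gaussian[OF gauss])
  define p where "p = predicted_prob A b z"
  \<comment> \<open>In this form the ratio is a finite combination of exponentials of linear
    functions of \<open>z' - z\<close>, so its mean is known in closed form.\<close>
  define Y where "Y j z' = (\<Sum>i\<in>UNIV. p $ i * exp ((row i A - row j A) \<bullet> (z' - z)))" for j z'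
  have KL: "KL p (predicted_prob A b z') = (\<Sum>j\<in>UNIV. p $ j * ln (Y j z'))" for z'
    by (simp add: KL_def p_def Y_def predicted_prob_ratio)
  have p_pos: "0 < p $ j" for j
    by (simp add: p_def predicted_prob_pos)
  have Y_int: "integrable N (Y j)" for j
    unfolding Y_def
    by (intro Bochner_Integration.integrable_sum integrable_mult_right integrable_gaussian_exp[OF gauss])
  have Y_ge: "p $ j \<le> Y j z'" for j z'
    using member_le_sum[of j UNIV "\<lambda>i. p $ i * exp ((row i A - row j A) \<bullet> (z' - z))"] p_pos
    by (simp add: Y_def less_imp_le)
  have EY: "expectation (Y j) =
      (\<Sum>i\<in>UNIV. p $ i * exp (1 / 2 * ((row i A - row j A) \<bullet> (\<Sigma> *v (row i A - row j A)))))" for j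
    unfolding Y_def
    by (subst Bochner_Integration.integral_sum)
      (simp_all only: integrable_mult_right integrable_gaussian_exp[OF gauss]
        integral_mult_right_zero integral_gaussian_exp[OF gauss])
  note ln_int = integrable_ln_bounded_below[OF Y_int p_pos Y_ge]
  note ln_le = expectation_ln_le[OF Y_int p_pos Y_ge]
  have "expectation (\<lambda>z'. KL p (predicted_prob A b z')) = (\<Sum>j\<in>UNIV. p $ j * expectation (\<lambda>z'. ln (Y j z')))"
    by (simp add: KL ln_int)
  also have "\<dots> \<le> (\<Sum>j\<in>UNIV. p $ j * ln (expectation (Y j)))"
    by (intro sum_mono mult_left_mono ln_le less_imp_le p_pos)
  finally show ?thesis
    \<comment> \<open>Folding \<open>p\<close> lets the rewriting of the divergence apply; unfolding
      it afterwards restores the softmax quotients of the statement.\<close>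
    unfolding EY by (simp add: KL ln_int predicted_prob_nth flip: p_def)
      (simp add: p_def predicted_prob_nth)
qed

end
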